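(* The general measurable solution $f:\mathbb{R}\to\mathbb{R}$ of the quadratic functional equation $$f(x+y)+f(x-y)=2f(x)+2f(y)\quad\text{for all } x,y\in\mathbb{R}$$ is of the form $f(x)=\lambda x^2$, where $\lambda\in\mathbb{R}$ is some constant; that is, a measurable function $f$ satisfies the equation if and only if there is $\lambda\in\mathbb{R}$ with $f(x)=\lambda x^2$ for all $x\in\mathbb{R}$.
   Context: "Measurable" means Lebesgue measurable. *)

theory Defs
  imports "HOL-Analysis.Analysis"
begin

end

theory Submission
  imports Defs
begin

text \<open>
  A solution \<open>f\<close> of the quadratic equation is recovered from its polarisation
  \<open>B x y = f (x + y) - f (x - y)\<close> as \<open>f x = B x x / 4\<close>. Comparing two instances of the equation shows
  that \<open>B\<close> satisfies Jensen's equation in its first argument, hence is additive there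
  (\<open>quadratic_polarisation_additive\<close>). So everything reduces to the classical theorem of Frechet
  that a Lebesgue measurable additive function is linear (\<open>additive_measurable_imp_linear\<close>):
  applied to \<open>B\<close> for a fixed second argument it gives \<open>B x y = x * B 1 y\<close>, and the symmetry of \<open>B\<close>
  turns this into \<open>B x y = x * y * B 1 1\<close>.

  The theorem on additive functions rests on a measure-theoretic pigeonhole. The sublevel sets
  \<open>{x \<in> {0..1}. \<bar>g x\<bar> \<le> n}\<close> exhaust \<open>{0..1}\<close>, so one of them, \<open>E\<close>, has measure more than \<open>3/4\<close>.
  For \<open>\<bar>d\<bar> \<le> 1/4\<close> the sets \<open>E\<close> and \<open>d + E\<close> both lie in an interval of length \<open>5/4\<close> and cannot
  be disjoint, so \<open>d\<close> is a difference of two points of \<open>E\<close> and \<open>\<bar>g d\<bar> \<le> 2 * n\<close>. An additive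
  function that is bounded near the origin is linear.
\<close>

section \<open>Additive functions\<close>

lemma additive_of_nat_mult:
  fixes g :: "real \<Rightarrow> real"
  assumes "Modules.additive g"
  shows "g (of_nat n * x) = of_nat n * g x"
proof -
  interpret Modules.additive g by fact
  show ?thesis
    by (induction n) (simp_all add: add zero algebra_simps)
qed

text \<open>
  Since \<open>h x = g x - g 1 * x\<close> is additive and vanishes at the positive integers, \<open>n * h x = h (n * x)\<close>
  is, for \<open>x \<ge> 0\<close>, the value of \<open>h\<close> at the fractional part of \<open>n * x\<close>. The bound on \<open>{-d..d}\<close> scales
  to one on \<open>{0..1}\<close>, so all multiples of \<open>h x\<close> obey one bound, which forces \<open>h x = 0\<close>.
\<close>

lemma additive_bounded_imp_linear:
  fixes g :: "real \<Rightarrow> real"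
  assumes g: "Modules.additive g" and d: "0 < d" and bd: "\<And>x. \<bar>x\<bar> \<le> d \<Longrightarrow> \<bar>g x\<bar> \<le> K"
  shows "g x = g 1 * x"
proof -
  interpret Modules.additive g by fact
  obtain m :: nat where m: "1 / d < of_nat m"
    using reals_Archimedean2 by blast
  have m0: "0 < real m"
    using m d less_trans[of 0 "1 / d" "real m"] by simp
  have unit_bd: "\<bar>g r\<bar> \<le> real m * K" if "\<bar>r\<bar> \<le> 1" for r
  proof -
    have "1 \<le> d * real m"
      using m d by (simp add: field_simps)
    then have "\<bar>r\<bar> \<le> d * real m"
      using that by linarith
    then have "\<bar>r / real m\<bar> \<le> d"
      using m0 by (simp add: field_simps)
    then have "\<bar>g (r / real m)\<bar> \<le> K"
      by (rule bd)
    moreover have "g r = real m * g (r / real m)"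
      using additive_of_nat_mult[OF g, of m "r / real m"] m0 by simp
    ultimately show ?thesis
      using m0 by (simp add: abs_mult)
  qed
  have pos: "g x = g 1 * x" if "0 \<le> x" for x
  proof (rule ccontr)
    define h where "h t = g t - g 1 * t" for t
    assume "g x \<noteq> g 1 * x"
    then have "0 < \<bar>h x\<bar>" by (simp add: h_def)
    then obtain n :: nat where n: "real m * K + \<bar>g 1\<bar> < of_nat n * \<bar>h x\<bar>"
      using reals_Archimedean3 by blast
    define k where "k = nat \<lfloor>real n * x\<rfloor>"
    define r where "r = real n * x - real k"
    have "real k = of_int \<lfloor>real n * x\<rfloor>"
      using that by (simp add: k_def)
    then have r: "0 \<le> r" "r \<le> 1"
      unfolding r_def by linarith+
    have "real n * g x = g (real k * 1 + r)"
      using additive_of_nat_mult[OF g, of n x] by (simp add: r_def)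
    also have "\<dots> = real k * g 1 + g r"
      using add[of "real k * 1" r] additive_of_nat_mult[OF g, of k 1] by simp
    finally have "real n * h x = g r - g 1 * r"
      by (simp add: h_def r_def algebra_simps)
    then have "real n * \<bar>h x\<bar> = \<bar>g r - g 1 * r\<bar>"
      using abs_mult[of "real n" "h x"] by simp
    also have "\<dots> \<le> \<bar>g r\<bar> + \<bar>g 1\<bar> * \<bar>r\<bar>"
      using abs_triangle_ineq4[of "g r" "g 1 * r"] by (simp add: abs_mult)
    also have "\<dots> \<le> real m * K + \<bar>g 1\<bar>"
      using r unit_bd[of r] mult_left_mono[of "\<bar>r\<bar>" 1 "\<bar>g 1\<bar>"] by simp
    finally show False using n by simp
  qed
  show ?thesis
    using pos[of x] pos[of "- x"] minus[of x] by (cases "0 \<le> x") auto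
qed

section \<open>Measurable additive functions\<close>

lemma large_subset_unit_interval_differences:
  fixes E :: "real set"
  assumes E: "E \<in> lmeasurable" "E \<subseteq> {0..1}" "3/4 < measure lebesgue E"
    and d: "\<bar>d\<bar> \<le> 1/4"
  shows "\<exists>u\<in>E. \<exists>v\<in>E. d = u - v"
proof (rule ccontr)
  assume no: "\<not> ?thesis"
  let ?T = "(+) d ` E"
  have T: "?T \<in> lmeasurable"
    using E(1) by (rule measurable_translation)
  have "E \<inter> ?T = {}"
  proof (rule ccontr)
    assume "E \<inter> ?T \<noteq> {}"
    then obtain v where "v \<in> E" "d + v \<in> E" by auto
    moreover have "d = (d + v) - v" by simp
    ultimately show False using no by blast
  qed
  then have "measure lebesgue (E \<union> ?T) = measure lebesgue E + measure lebesgue ?T"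
    using fmeasurableD2[OF E(1)] fmeasurableD2[OF T] fmeasurableD[OF E(1)] fmeasurableD[OF T]
    by (intro measure_Union) (simp_all only: infinity_ennreal_def not_False_eq_True)
  then have big: "3/2 < measure lebesgue (E \<union> ?T)"
    using E(3) by (simp add: measure_translation)
  \<comment> \<open>The interval has length \<open>1 + \<bar>d\<bar>\<close>, at most \<open>5/4\<close>.\<close>
  have "E \<union> ?T \<subseteq> {min 0 d..max 1 (1 + d)}"
    using subsetD[OF E(2)] by (fastforce simp: min_le_iff_disj le_max_iff_disj)
  then have "measure lebesgue (E \<union> ?T) \<le> measure lebesgue {min 0 d..max 1 (1 + d)}"
    using fmeasurableD[OF E(1)] fmeasurableD[OF T]
    by (intro measure_mono_fmeasurable sets.Un lmeasurable_interval)
  also have "\<dots> \<le> 5/4"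
    using d by (auto simp: min_def max_def)
  finally show False using big by simp
qed

lemma additive_measurable_bounded_near_0:
  fixes g :: "real \<Rightarrow> real"
  assumes g: "Modules.additive g" and meas: "g \<in> borel_measurable lebesgue"
  shows "\<exists>K. \<forall>x. \<bar>x\<bar> \<le> 1/4 \<longrightarrow> \<bar>g x\<bar> \<le> K"
proof -
  interpret Modules.additive g by fact
  define E where "E n = {x \<in> {0..1}. \<bar>g x\<bar> \<le> real n}" for n
  have E: "E n \<in> lmeasurable" for n
  proof (rule fmeasurableI2[of "{0..1::real}"])
    have "{x \<in> space lebesgue. \<bar>g x\<bar> \<le> real n} \<in> sets lebesgue"
      using meas by measurable
    then have "{0..1} \<inter> {x. \<bar>g x\<bar> \<le> real n} \<in> sets lebesgue"
      by (intro sets.Int) simp_all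
    then show "E n \<in> sets lebesgue"
      by (simp only: E_def Collect_conj_eq Collect_mem_eq)
    show "E n \<subseteq> {0..1}" by (auto simp: E_def)
  qed simp
  have Union_E: "(\<Union>n. E n) = {0..1}"
    using real_arch_simple by (auto simp: E_def)
  have "(\<lambda>n. measure lebesgue (E n)) \<longlonglongrightarrow> measure lebesgue (\<Union>n. E n)"
  proof (rule Lim_measure_incseq)
    show "range E \<subseteq> sets lebesgue" using fmeasurableD[OF E] by blast
    show "incseq E" by (force simp: E_def incseq_def)
    show "emeasure lebesgue (\<Union>n. E n) \<noteq> \<infinity>" by (simp add: Union_E)
  qed
  then have "(\<lambda>n. measure lebesgue (E n)) \<longlonglongrightarrow> 1"
    by (simp add: Union_E)
  then have "\<forall>\<^sub>F n in sequentially. 3/4 < measure lebesgue (E n)"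
    by (rule order_tendstoD) simp
  then obtain n where n: "3/4 < measure lebesgue (E n)"
    by (auto simp: eventually_sequentially)
  have "\<bar>g x\<bar> \<le> 2 * real n" if x: "\<bar>x\<bar> \<le> 1/4" for x
  proof -
    have "E n \<subseteq> {0..1}" by (auto simp: E_def)
    then obtain u v where uv: "u \<in> E n" "v \<in> E n" "x = u - v"
      using large_subset_unit_interval_differences[OF E _ n x] by blast
    then have "\<bar>g u\<bar> \<le> real n" "\<bar>g v\<bar> \<le> real n"
      by (auto simp: E_def)
    then show ?thesis
      using diff[of u v] uv(3) by simp
  qed
  then show ?thesis by blast
qed

theorem additive_measurable_imp_linear:
  fixes g :: "real \<Rightarrow> real"
  assumes "Modules.additive g" and "g \<in> borel_measurable lebesgue"
  shows "g x = g 1 * x"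
proof -
  obtain K where "\<And>x. \<bar>x\<bar> \<le> 1/4 \<Longrightarrow> \<bar>g x\<bar> \<le> K"
    using additive_measurable_bounded_near_0[OF assms] by blast
  then show ?thesis
    by (rule additive_bounded_imp_linear[OF assms(1), of "1/4", rotated]) simp_all
qed

section \<open>The quadratic equation\<close>

lemma quadratic_at_0:
  fixes f :: "real \<Rightarrow> real"
  assumes "\<And>x y. f (x + y) + f (x - y) = 2 * f x + 2 * f y"
  shows "f 0 = 0"
  using assms[of 0 0] by simp

lemma quadratic_even:
  fixes f :: "real \<Rightarrow> real"
  assumes "\<And>x y. f (x + y) + f (x - y) = 2 * f x + 2 * f y"
  shows "f (- x) = f x"
  using assms[of 0 x] quadratic_at_0[OF assms] by simp

text \<open>
  Subtracting the equation at \<open>(x - y, z)\<close> from the one at \<open>(x + y, z)\<close> eliminates \<open>f z\<close> and leaves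
  Jensen's equation \<open>B (x + z) y + B (x - z) y = 2 * B x y\<close> for the polarisation \<open>B\<close>. As \<open>f\<close> is even,
  \<open>B 0 y = 0\<close>, and a solution of Jensen's equation that vanishes at \<open>0\<close> is additive.
\<close>

lemma quadratic_polarisation_additive:
  fixes f :: "real \<Rightarrow> real"
  assumes q: "\<And>x y. f (x + y) + f (x - y) = 2 * f x + 2 * f y"
  shows "Modules.additive (\<lambda>x. f (x + y) - f (x - y))"
proof
  define B where "B x = f (x + y) - f (x - y)" for x
  have jensen: "B (x + z) + B (x - z) = 2 * B x" for x z
    using q[of "x + y" z] q[of "x - y" z] by (simp add: B_def algebra_simps)
  have "B 0 = 0"
    using quadratic_even[OF q, of y] by (simp add: B_def)
  then have double: "B (2 * x) = 2 * B x" for x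
    using jensen[of x x] by simp
  fix u v :: real
  have "(u + v) / 2 + (u - v) / 2 = u" "(u + v) / 2 - (u - v) / 2 = v" "2 * ((u + v) / 2) = u + v"
    by (simp_all flip: add_divide_distrib diff_divide_distrib)
  then have "B u + B v = B (u + v)"
    using jensen[of "(u + v) / 2" "(u - v) / 2"] double[of "(u + v) / 2"] by (metis (no_types))
  then show "f (u + v + y) - f (u + v - y) = f (u + y) - f (u - y) + (f (v + y) - f (v - y))"
    by (simp add: B_def)
qed

lemma borel_measurable_lebesgue_translation:
  fixes f :: "real \<Rightarrow> real"
  assumes "f \<in> borel_measurable lebesgue"
  shows "(\<lambda>x. f (x + a)) \<in> borel_measurable lebesgue"
proof -
  have "(\<lambda>x::real. a + x) \<in> lebesgue \<rightarrow>\<^sub>M lebesgue"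
    using lebesgue_affine_measurable[of "\<lambda>_. 1" a] by simp
  from measurable_compose[OF this assms] show ?thesis
    by (simp add: add.commute)
qed

theorem theorem5p1:
  fixes f :: "real \<Rightarrow> real"
  assumes "f \<in> borel_measurable lebesgue"
  shows "(\<forall>x y. f (x + y) + f (x - y) = 2 * f x + 2 * f y)
    \<longleftrightarrow> (\<exists>c::real. \<forall>x. f x = c * x\<^sup>2)"
proof
  assume "\<forall>x y. f (x + y) + f (x - y) = 2 * f x + 2 * f y"
  then have q: "\<And>x y. f (x + y) + f (x - y) = 2 * f x + 2 * f y" by blast
  define B where "B x y = f (x + y) - f (x - y)" for x y
  have "(\<lambda>x. B x y) \<in> borel_measurable lebesgue" for y
    unfolding B_def
    using borel_measurable_lebesgue_translation[OF assms, of y]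
      borel_measurable_lebesgue_translation[OF assms, of "- y"]
    by (intro borel_measurable_diff) simp_all
  moreover have "Modules.additive (\<lambda>x. B x y)" for y
    unfolding B_def using q by (rule quadratic_polarisation_additive)
  ultimately have linear: "B x y = B 1 y * x" for x y
    using additive_measurable_imp_linear by blast
  have symmetric: "B x y = B y x" for x y
    using quadratic_even[OF q, of "x - y"] by (simp add: B_def add.commute)
  have diagonal: "B x x = 4 * f x" for x
    using q[of x x] quadratic_at_0[OF q] by (simp add: B_def)
  have "f x = B 1 1 / 4 * x\<^sup>2" for x
    using linear[of x x] linear[of x 1] symmetric[of 1 x] diagonal[of x]
    by (simp add: power2_eq_square)
  then show "\<exists>c. \<forall>x. f x = c * x\<^sup>2" by blast
next
  assume "\<exists>c. \<forall>x. f x = c * x\<^sup>2"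
  then show "\<forall>x y. f (x + y) + f (x - y) = 2 * f x + 2 * f y"
    by (auto simp: power2_eq_square algebra_simps)
qed

end
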